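(* The function $\Psi_t(\cdot)$ defined in the context is square integrable with respect to the Lebesgue measure if $\frac12<\alpha<\frac{1+\gamma}{2}$ and $\gamma\in(0,1)$. In this case, $\int_{-\infty}^{\infty}|\Psi_t(s)|^2\,\mathrm ds=1$. The function $\Psi_t(\cdot)$ is not square integrable with respect to the Lebesgue measure if $\alpha\in(-\frac12+\frac\gamma2,\frac12)\setminus\{0\}$ and $\gamma\in(0,1)$.
   Context: For $\gamma\in[0,1)$, $\alpha\in\left(-\frac12+\frac\gamma2,\ \frac12+\frac\gamma2\right)\setminus\{0\}$ and $t>0$, put $H=\alpha-\frac\gamma2+\frac12$ and define $$\Psi_t(s):=C_t^{-1}\left[\alpha(t-s)^{\alpha-1}s^{-\gamma/2}\,\mathbf 1_{\{0<s<t\}}+\alpha(t-s)^{\alpha-1}(-s)^{-\gamma/2}\,\mathbf 1_{\{s<0\}}\right],\qquad s\in\mathbb R,$$ where $C_t$ is the time-dependent normalizing constant $$C_t:=\alpha\,t^{H}\left(\mathrm{Beta}(1-\gamma,2\alpha-1)+\mathrm{Beta}(1-\gamma,1-2\alpha+\gamma)\right)^{1/2},\qquad t>0,$$ and $\mathrm{Beta}(a,b)=\int_0^1x^{a-1}(1-x)^{b-1}\,\mathrm dx$, $a,b>0$, is the Beta function.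
   Formalization: The exponent H of t in C_t is corrected to H-1 (with t^H the integral equals t^(-2), not 1); for α<1/2, where Beta(1-γ,2α-1) and so C_t is undefined, non-square-integrability is stated with C_t replaced by an arbitrary nonzero real constant. *)

theory Defs
  imports "HOL-Analysis.Analysis"
begin

definition self_sim_index :: "real \<Rightarrow> real \<Rightarrow> real" where
  "self_sim_index \<gamma> \<alpha> = \<alpha> - \<gamma> / 2 + 1 / 2"

(* The exponent of t is H - 1, where the source prints H. The substitution s = t * x gives
     int_0^t (\<alpha> (t - s)^(\<alpha>-1) s^(-\<gamma>/2))^2 ds
       = \<alpha>^2 t^(2 \<alpha> - 1 - \<gamma>) Beta(1 - \<gamma>, 2 \<alpha> - 1)
   and likewise for s < 0, with 2 \<alpha> - 1 - \<gamma> = 2 (H - 1); the printed exponent would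
   make the squared L2 norm t^(-2) instead of 1.
   The square root and the Beta values have their intended meaning only when all arguments of
   Beta are positive, that is, when 1/2 < \<alpha> < (1 + \<gamma>) / 2 and \<gamma> < 1; there the
   library's Beta is the Euler integral (has_integral_Beta_real). *)
definition norm_const :: "real \<Rightarrow> real \<Rightarrow> real \<Rightarrow> real" where
  "norm_const \<gamma> \<alpha> t =
     \<alpha> * t powr (self_sim_index \<gamma> \<alpha> - 1) *
     sqrt (Beta (1 - \<gamma>) (2 * \<alpha> - 1) + Beta (1 - \<gamma>) (1 - 2 * \<alpha> + \<gamma>))"

(* The normalizing constant is the parameter c, because for \<alpha> < 1/2 the integral defining
   Beta (1 - \<gamma>) (2 * \<alpha> - 1) diverges and norm_const has no meaning. *)
definition Psi :: "real \<Rightarrow> real \<Rightarrow> real \<Rightarrow> real \<Rightarrow> real \<Rightarrow> real" where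
  "Psi c \<gamma> \<alpha> t s = inverse c *
     (\<alpha> * (t - s) powr (\<alpha> - 1) * s powr (- \<gamma> / 2) * indicator {0<..<t} s +
      \<alpha> * (t - s) powr (\<alpha> - 1) * (- s) powr (- \<gamma> / 2) * indicator {..<0} s)"

definition square_integrable :: "(real \<Rightarrow> real) \<Rightarrow> bool" where
  "square_integrable f \<longleftrightarrow>
     f \<in> borel_measurable lebesgue \<and> integrable lebesgue (\<lambda>s. \<bar>f s\<bar>\<^sup>2)"

end

theory Submission
  imports Defs
begin

text \<open>Squaring \<open>\<Psi>\<^sub>t\<close> leaves two power integrals: the substitution \<open>s = t x\<close> turns the
  one over \<open>(0, t)\<close> into the Euler integral of \<open>Beta (1 - \<gamma>) (2 \<alpha> - 1)\<close>, and
  \<open>s = - t x / (1 - x)\<close> turns the one over \<open>(-\<infinity>, 0)\<close> into that of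
  \<open>Beta (1 - \<gamma>) (1 - 2 \<alpha> + \<gamma>)\<close>, both with the factor \<open>t\<^bsup>2 \<alpha> - 1 - \<gamma>\<^esup>\<close>.
  For \<open>\<alpha> < 1 / 2\<close> the square dominates a multiple of \<open>1 / (t - s)\<close> to the left of \<open>t\<close>.\<close>

text \<open>The change of variables theorem speaks of absolute integrability. For a nonnegative
  integrand this is the same as integrability, so the value can be carried along as a plain
  \<open>has_integral\<close>. Since \<open>S\<close> need not be compact and only
  \<open>\<bar>g' x\<bar>\<close> enters, open intervals and decreasing substitutions are
  covered.\<close>

lemma has_integral_substitution_nonneg:
  fixes f g g' :: "real \<Rightarrow> real"
  assumes S: "S \<in> sets lebesgue"
    and deriv: "\<And>x. x \<in> S \<Longrightarrow> (g has_field_derivative g' x) (at x within S)"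
    and inj: "inj_on g S"
    and nonneg: "\<And>x. x \<in> S \<Longrightarrow> f (g x) \<ge> 0"
    and I: "((\<lambda>x. \<bar>g' x\<bar> * f (g x)) has_integral I) S"
  shows "(f has_integral I) (g ` S)"
proof -
  have "(\<lambda>x. \<bar>g' x\<bar> * f (g x)) absolutely_integrable_on S"
    using I nonneg by (intro nonnegative_absolutely_integrable_1) auto
  moreover have "integral S (\<lambda>x. \<bar>g' x\<bar> * f (g x)) = I"
    using I by (rule integral_unique)
  ultimately have "f absolutely_integrable_on g ` S \<and> integral (g ` S) f = I"
    using has_absolute_integral_change_of_variables_1'[OF S deriv inj] by blast
  then show ?thesis
    by (simp add: has_integral_iff set_lebesgue_integral_eq_integral)
qed

lemma has_integral_Beta_scaled:
  fixes a b t :: real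
  assumes "a > 0" "b > 0" "t > 0"
  shows "((\<lambda>s. (t - s) powr (b - 1) * s powr (a - 1)) has_integral
           t powr (a + b - 1) * Beta a b) {0<..<t}"
proof -
  have image: "(\<lambda>x. t * x) ` {0<..<1} = {0<..<t}"
  proof (intro equalityI subsetI)
    fix s assume "s \<in> {0<..<t}"
    then have "s = t * (s / t)" "s / t \<in> {0<..<1}" using assms by auto
    then show "s \<in> (\<lambda>x. t * x) ` {0<..<1}" by (rule image_eqI)
  qed (use assms in auto)
  have "((\<lambda>x. t powr (a + b - 1) * (x powr (a - 1) * (1 - x) powr (b - 1))) has_integral
          t powr (a + b - 1) * Beta a b) {0<..<1}"
    using has_integral_Beta_real[of a b] assms
    by (intro has_integral_mult_right) (simp add: has_integral_Icc_iff_Ioo)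
  also have "?this \<longleftrightarrow> ((\<lambda>x. \<bar>t\<bar> * ((t - t * x) powr (b - 1) * (t * x) powr (a - 1))) has_integral
          t powr (a + b - 1) * Beta a b) {0<..<1}"
  proof (intro has_integral_cong)
    fix x :: real assume x: "x \<in> {0<..<1}"
    have "t - t * x = t * (1 - x)" by (simp add: algebra_simps)
    \<comment> \<open>The three powers of \<open>t\<close> come from the Jacobian, from
      \<open>t - t * x\<close> and from \<open>t * x\<close>.\<close>
    moreover have "t powr (a + b - 1) = t powr 1 * t powr (b - 1) * t powr (a - 1)"
      unfolding powr_add[symmetric] by (simp add: algebra_simps)
    ultimately show "t powr (a + b - 1) * (x powr (a - 1) * (1 - x) powr (b - 1)) =
        \<bar>t\<bar> * ((t - t * x) powr (b - 1) * (t * x) powr (a - 1))"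
      using x assms by (simp add: powr_mult)
  qed
  finally show ?thesis
    unfolding image[symmetric] using assms
    by (intro has_integral_substitution_nonneg[where g' = "\<lambda>_. t"])
       (auto intro!: derivative_eq_intros inj_onI)
qed

lemma has_integral_Beta_prime_scaled:
  fixes a b t :: real
  assumes "a > 0" "b > 0" "t > 0"
  shows "((\<lambda>s. (t - s) powr (- a - b) * (- s) powr (a - 1)) has_integral
           t powr (- b) * Beta a b) {..<0}"
proof -
  \<comment> \<open>This is \<open>- t * x / (1 - x)\<close>, written so that
    \<open>t - ?g x\<close> is visibly \<open>t / (1 - x)\<close>. The map is decreasing, and its
    inverse is \<open>s / (s - t)\<close>.\<close>
  let ?g = "\<lambda>x::real. t - t / (1 - x)"
  have image: "?g ` {0<..<1} = {..<0}"
  proof (intro equalityI subsetI)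
    fix s assume "s \<in> ?g ` {0<..<1}"
    then show "s \<in> {..<0}" using assms by (auto simp: field_simps)
  next
    fix s :: real assume "s \<in> {..<0}"
    then have "s = ?g (s / (s - t))" "s / (s - t) \<in> {0<..<1}"
      using assms by (auto simp: field_simps)
    then show "s \<in> ?g ` {0<..<1}" by (rule image_eqI)
  qed
  have "((\<lambda>x. t powr (- b) * (x powr (a - 1) * (1 - x) powr (b - 1))) has_integral
          t powr (- b) * Beta a b) {0<..<1}"
    using has_integral_Beta_real[of a b] assms
    by (intro has_integral_mult_right) (simp add: has_integral_Icc_iff_Ioo)
  also have "?this \<longleftrightarrow> ((\<lambda>x. \<bar>- t / (1 - x)\<^sup>2\<bar> *
      ((t - ?g x) powr (- a - b) * (- ?g x) powr (a - 1))) has_integral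
          t powr (- b) * Beta a b) {0<..<1}"
  proof (intro has_integral_cong)
    fix x :: real assume x: "x \<in> {0<..<1}"
    have g: "- ?g x = t * x / (1 - x)" using x by (simp add: field_simps)
    have t: "t powr (- b) = t powr 1 * t powr (- a - b) * t powr (a - 1)"
      unfolding powr_add[symmetric] by (simp add: algebra_simps)
    \<comment> \<open>The exponent \<open>b - 1\<close> is split by origin: \<open>- 2\<close> from
      the Jacobian, \<open>a + b\<close> from \<open>t - ?g x\<close> and \<open>- (a - 1)\<close>
      from \<open>- ?g x\<close>.\<close>
    have "(1 - x) powr (b - 1) =
        (1 - x) powr (- 2) * (1 - x) powr - (- a - b) * (1 - x) powr - (a - 1)"
      unfolding powr_add[symmetric] by (simp add: algebra_simps)
    also have "\<dots> = 1 / (1 - x)\<^sup>2 / (1 - x) powr (- a - b) / (1 - x) powr (a - 1)"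
      using x by (subst (1 2 3) powr_minus) (simp add: divide_simps)
    finally have x1: "(1 - x) powr (b - 1) =
        1 / (1 - x)\<^sup>2 / (1 - x) powr (- a - b) / (1 - x) powr (a - 1)" .
    show "t powr (- b) * (x powr (a - 1) * (1 - x) powr (b - 1)) =
        \<bar>- t / (1 - x)\<^sup>2\<bar> * ((t - ?g x) powr (- a - b) * (- ?g x) powr (a - 1))"
      unfolding t x1 g using x assms by (simp add: powr_mult powr_divide)
  qed
  finally show ?thesis
    unfolding image[symmetric]
  proof (intro has_integral_substitution_nonneg[where g' = "\<lambda>x. - t / (1 - x)\<^sup>2"])
    fix x :: real assume "x \<in> {0<..<1}"
    then show "(?g has_field_derivative - t / (1 - x)\<^sup>2) (at x within {0<..<1})"
      by (auto intro!: derivative_eq_intros simp: power2_eq_square)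
  next
    show "inj_on ?g {0<..<1}"
      using assms by (intro inj_onI) (simp add: frac_eq_eq)
  qed auto
qed

text \<open>An indefinite integral is continuous in its upper end, hence bounded on the compact
  interval. Here it would be \<open>ln (t - a) - ln (t - x)\<close>, which is unbounded as
  \<open>x\<close> tends to \<open>t\<close>.\<close>

lemma not_integrable_on_inverse_diff:
  fixes a t :: real
  assumes "a < t"
  shows "\<not> (\<lambda>s. inverse (t - s)) integrable_on {a..t}"
proof
  assume int: "(\<lambda>s. inverse (t - s)) integrable_on {a..t}"
  let ?F = "\<lambda>x. integral {a..x} (\<lambda>s. inverse (t - s))"
  have "compact (?F ` {a..t})"
    by (intro compact_continuous_image indefinite_integral_continuous_1 int) auto
  then obtain M where M: "\<And>x. x \<in> {a..t} \<Longrightarrow> ?F x \<le> M"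
    by (meson compact_imp_bounded bounded_imp_bdd_above bdd_above.E image_eqI)
  have F: "?F x = ln (t - a) - ln (t - x)" if "x \<in> {a..<t}" for x
  proof -
    have "((\<lambda>s. inverse (t - s)) has_integral (- ln (t - x) - - ln (t - a))) {a..x}"
      using that
      by (intro fundamental_theorem_of_calculus)
         (auto intro!: derivative_eq_intros
               simp: has_real_derivative_iff_has_vector_derivative[symmetric] field_simps)
    then show ?thesis by (simp add: integral_unique)
  qed
  \<comment> \<open>Solves \<open>?F x = \<bar>M\<bar> + 1\<close>, a value above \<open>M\<close>.
    The absolute value makes the exponential at most 1, which keeps \<open>x\<close> in
    \<open>{a..<t}\<close>.\<close>
  define x where "x = t - (t - a) * exp (- \<bar>M\<bar> - 1)"
  have "(t - a) * exp (- \<bar>M\<bar> - 1) \<le> t - a" "(t - a) * exp (- \<bar>M\<bar> - 1) > 0"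
    using assms by (simp_all add: mult_left_le)
  then have x: "x \<in> {a..<t}"
    by (simp add: x_def)
  then have "?F x = \<bar>M\<bar> + 1"
    using assms by (simp add: F x_def ln_mult)
  with M[of x] x show False by auto
qed

text \<open>The two indicators have disjoint supports, so squaring produces no cross term. The
  conditionals on set membership have the shape that \<open>has_integral_restrict_UNIV\<close>
  expects.\<close>

lemma Psi_square:
  "\<bar>Psi c \<gamma> \<alpha> t s\<bar>\<^sup>2 = \<alpha>\<^sup>2 / c\<^sup>2 *
     ((if s \<in> {0<..<t} then (t - s) powr (2 * \<alpha> - 2) * s powr (- \<gamma>) else 0) +
      (if s \<in> {..<0} then (t - s) powr (2 * \<alpha> - 2) * (- s) powr (- \<gamma>) else 0))"
proof -
  have sq: "x powr (2 * y) = (x powr y)\<^sup>2" for x y :: real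
    using powr_add[of x y y] by (simp only: mult_2 power2_eq_square)
  have sqs: "(t - s) powr (2 * \<alpha> - 2) = ((t - s) powr (\<alpha> - 1))\<^sup>2"
    "s powr (- \<gamma>) = (s powr (- \<gamma> / 2))\<^sup>2" "(- s) powr (- \<gamma>) = ((- s) powr (- \<gamma> / 2))\<^sup>2"
    using sq[of "t - s" "\<alpha> - 1"] sq[of s "- \<gamma> / 2"] sq[of "- s" "- \<gamma> / 2"]
    by (simp_all only: right_diff_distrib) simp_all
  consider "s \<in> {..<0}" | "s \<in> {0<..<t}" | "s \<notin> {..<0}" "s \<notin> {0<..<t}"
    by blast
  then show ?thesis
    unfolding sqs Psi_def
    by cases (auto simp: power_mult_distrib inverse_eq_divide power_divide)
qed

lemma Psi_measurable: "Psi c \<gamma> \<alpha> t \<in> borel_measurable lebesgue"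
proof -
  have "Psi c \<gamma> \<alpha> t \<in> borel_measurable lborel"
    unfolding Psi_def [abs_def] by measurable
  then show ?thesis
    by (rule measurable_completion)
qed

lemma has_integral_Psi_square:
  fixes \<gamma> \<alpha> t :: real
  assumes "\<gamma> < 1" "t > 0" "1 / 2 < \<alpha>" "\<alpha> < (1 + \<gamma>) / 2"
  shows "((\<lambda>s. \<bar>Psi (norm_const \<gamma> \<alpha> t) \<gamma> \<alpha> t s\<bar>\<^sup>2) has_integral 1) UNIV"
proof -
  define B where "B = Beta (1 - \<gamma>) (2 * \<alpha> - 1) + Beta (1 - \<gamma>) (1 - 2 * \<alpha> + \<gamma>)"
  define T where "T = t powr (2 * \<alpha> - 1 - \<gamma>)"
  \<comment> \<open>Positivity of \<open>B\<close> lets the square cancel the square root in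
    \<open>norm_const\<close>, and allows the division by \<open>B\<close> at the end.\<close>
  have "Beta a b > 0" if "a > 0" "b > 0" for a b :: real
    using that by (simp add: Beta_def Gamma_real_pos)
  then have "B > 0"
    unfolding B_def using assms by (intro add_pos_pos) auto
  \<comment> \<open>Twice the exponent \<open>H - 1\<close> is
    \<open>2 * \<alpha> - 1 - \<gamma>\<close>, the power of \<open>t\<close> that both Beta
    integrals below carry.\<close>
  have "(t powr (self_sim_index \<gamma> \<alpha> - 1))\<^sup>2 = T"
    unfolding T_def power2_eq_square powr_add[symmetric]
    by (simp add: self_sim_index_def algebra_simps)
  then have c: "(norm_const \<gamma> \<alpha> t)\<^sup>2 = \<alpha>\<^sup>2 * T * B"
    using \<open>B > 0\<close> by (simp add: norm_const_def power_mult_distrib flip: B_def)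
  have "((\<lambda>s. (t - s) powr (2 * \<alpha> - 2) * s powr (- \<gamma>)) has_integral
          T * Beta (1 - \<gamma>) (2 * \<alpha> - 1)) {0<..<t}"
    using has_integral_Beta_scaled[of "1 - \<gamma>" "2 * \<alpha> - 1" t] assms
    by (simp add: T_def algebra_simps)
  moreover have "((\<lambda>s. (t - s) powr (2 * \<alpha> - 2) * (- s) powr (- \<gamma>)) has_integral
          T * Beta (1 - \<gamma>) (1 - 2 * \<alpha> + \<gamma>)) {..<0}"
    using has_integral_Beta_prime_scaled[of "1 - \<gamma>" "1 - 2 * \<alpha> + \<gamma>" t] assms
    by (simp add: T_def algebra_simps)
  ultimately have "((\<lambda>s. \<bar>Psi (norm_const \<gamma> \<alpha> t) \<gamma> \<alpha> t s\<bar>\<^sup>2) has_integral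
      \<alpha>\<^sup>2 / (norm_const \<gamma> \<alpha> t)\<^sup>2 *
        (T * Beta (1 - \<gamma>) (2 * \<alpha> - 1) + T * Beta (1 - \<gamma>) (1 - 2 * \<alpha> + \<gamma>))) UNIV"
    unfolding Psi_square
    by (intro has_integral_mult_right has_integral_add) (simp_all only: has_integral_restrict_UNIV)
  moreover have "\<alpha>\<^sup>2 / (norm_const \<gamma> \<alpha> t)\<^sup>2 *
        (T * Beta (1 - \<gamma>) (2 * \<alpha> - 1) + T * Beta (1 - \<gamma>) (1 - 2 * \<alpha> + \<gamma>)) = 1"
    unfolding c distrib_left[symmetric] B_def[symmetric]
    using \<open>B > 0\<close> assms by (simp add: T_def)
  ultimately show ?thesis by (simp only:)
qed

lemma not_square_integrable_Psi:
  fixes \<gamma> \<alpha> t c :: real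
  assumes "0 < \<gamma>" "t > 0" "\<alpha> < 1 / 2" "\<alpha> \<noteq> 0" "c \<noteq> 0"
  shows "\<not> square_integrable (Psi c \<gamma> \<alpha> t)"
proof
  assume "square_integrable (Psi c \<gamma> \<alpha> t)"
  then have int: "integrable lebesgue (\<lambda>s. \<bar>Psi c \<gamma> \<alpha> t s\<bar>\<^sup>2)"
    by (simp add: square_integrable_def)
  define K where "K = \<alpha>\<^sup>2 / c\<^sup>2 * (t powr (2 * \<alpha> - 1) * t powr (- \<gamma>))"
  have "K > 0" using assms by (simp add: K_def)
  have bound: "K * inverse (t - s) \<le> \<bar>Psi c \<gamma> \<alpha> t s\<bar>\<^sup>2" if s: "s \<in> {0<..<t}" for s
  proof -
    have "(t - s) powr (2 * \<alpha> - 2) = (t - s) powr (2 * \<alpha> - 1) * (t - s) powr (- 1)"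
      unfolding powr_add[symmetric] by (simp add: algebra_simps)
    also have "(t - s) powr (- 1) = inverse (t - s)"
      using s by (simp add: powr_minus)
    finally have "(t - s) powr (2 * \<alpha> - 2) * s powr (- \<gamma>) =
        (t - s) powr (2 * \<alpha> - 1) * s powr (- \<gamma>) * inverse (t - s)"
      by simp
    \<comment> \<open>One factor \<open>inverse (t - s)\<close> has been split off. The remaining
      exponents \<open>2 * \<alpha> - 1\<close> and \<open>- \<gamma>\<close> are negative, so both
      powers decrease in their bases, and these bases are at most \<open>t\<close>.\<close>
    moreover have "t powr (2 * \<alpha> - 1) * t powr (- \<gamma>) \<le> (t - s) powr (2 * \<alpha> - 1) * s powr (- \<gamma>)"
      using s assms by (intro mult_mono powr_mono2') auto
    ultimately have "t powr (2 * \<alpha> - 1) * t powr (- \<gamma>) * inverse (t - s) \<le>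
        (t - s) powr (2 * \<alpha> - 2) * s powr (- \<gamma>)"
      using s by (simp only:) (intro mult_right_mono, auto)
    then have "K * inverse (t - s) \<le> \<alpha>\<^sup>2 / c\<^sup>2 * ((t - s) powr (2 * \<alpha> - 2) * s powr (- \<gamma>))"
      unfolding K_def mult.assoc by (rule mult_left_mono) simp
    then show ?thesis
      using s unfolding Psi_square by simp
  qed
  have "(\<lambda>s. K * inverse (t - s)) absolutely_integrable_on {0..t}"
    unfolding set_integrable_def
  proof (rule Bochner_Integration.integrable_bound[OF int])
    show "(\<lambda>s. indicat_real {0..t} s *\<^sub>R (K * inverse (t - s))) \<in> borel_measurable lebesgue"
      by (intro measurable_completion) measurable
    \<comment> \<open>At \<open>s = 0\<close> both indicators in \<open>Psi\<close> vanish and the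
      bound fails, so this null set is left out. At \<open>s = t\<close> the convention
      \<open>inverse 0 = 0\<close> makes the left side zero.\<close>
    have "norm (indicat_real {0..t} s *\<^sub>R (K * inverse (t - s))) \<le> norm (\<bar>Psi c \<gamma> \<alpha> t s\<bar>\<^sup>2)"
      if "s \<noteq> 0" for s
      using that bound[of s] \<open>K > 0\<close> by (cases "s = t") (auto simp: indicator_def abs_mult)
    then show "AE s in lebesgue. norm (indicat_real {0..t} s *\<^sub>R (K * inverse (t - s)))
        \<le> norm (\<bar>Psi c \<gamma> \<alpha> t s\<bar>\<^sup>2)"
      by (intro AE_I'[of "{0}"]) auto
  qed
  then have "(\<lambda>s. K * inverse (t - s)) integrable_on {0..t}"
    by (rule set_lebesgue_integral_eq_integral)
  then have "(\<lambda>s. inverse (t - s)) integrable_on {0..t}"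
    using \<open>K > 0\<close> by (simp add: integrable_on_mult_right_iff)
  with not_integrable_on_inverse_diff[of 0 t] assms show False by simp
qed

theorem lemma3p1:
  fixes \<gamma> \<alpha> t :: real
  assumes "0 < \<gamma>" and "\<gamma> < 1" and "t > 0"
  shows "(1 / 2 < \<alpha> \<and> \<alpha> < (1 + \<gamma>) / 2 \<longrightarrow>
            square_integrable (Psi (norm_const \<gamma> \<alpha> t) \<gamma> \<alpha> t) \<and>
            (LINT s|lebesgue. \<bar>Psi (norm_const \<gamma> \<alpha> t) \<gamma> \<alpha> t s\<bar>\<^sup>2) = 1) \<and>
         (\<alpha> \<in> {- 1 / 2 + \<gamma> / 2<..<1 / 2} - {0} \<longrightarrow>
            (\<forall>c. c \<noteq> 0 \<longrightarrow> \<not> square_integrable (Psi c \<gamma> \<alpha> t)))"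
proof (intro conjI impI)
  assume "1 / 2 < \<alpha> \<and> \<alpha> < (1 + \<gamma>) / 2"
  then have int: "((\<lambda>s. \<bar>Psi (norm_const \<gamma> \<alpha> t) \<gamma> \<alpha> t s\<bar>\<^sup>2) has_integral 1) UNIV"
    using assms by (intro has_integral_Psi_square) auto
  \<comment> \<open>Nonnegativity turns the gauge integral into a Lebesgue integral with the same
    value.\<close>
  then have abs: "(\<lambda>s. \<bar>Psi (norm_const \<gamma> \<alpha> t) \<gamma> \<alpha> t s\<bar>\<^sup>2) absolutely_integrable_on UNIV"
    by (intro nonnegative_absolutely_integrable_1) auto
  then show "square_integrable (Psi (norm_const \<gamma> \<alpha> t) \<gamma> \<alpha> t)"
    by (simp add: square_integrable_def Psi_measurable set_integrable_def)
  show "(LINT s|lebesgue. \<bar>Psi (norm_const \<gamma> \<alpha> t) \<gamma> \<alpha> t s\<bar>\<^sup>2) = 1"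
    using set_lebesgue_integral_eq_integral(2)[OF abs] integral_unique[OF int]
    by (simp add: set_lebesgue_integral_def)
next
  assume "\<alpha> \<in> {- 1 / 2 + \<gamma> / 2<..<1 / 2} - {0}"
  then show "\<forall>c. c \<noteq> 0 \<longrightarrow> \<not> square_integrable (Psi c \<gamma> \<alpha> t)"
    using assms not_square_integrable_Psi by auto
qed

end
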